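(* For every finite simple group $G$ with identity element $e$, there is a word $w(x,y) \in F(x,y)$, where $F(x,y)$ is the free group on the two generators $x, y$, with the following property: for every $(a,b) \in G \times G$, $w(a,b) \neq e$ if and only if $\langle a, b \rangle = G$.
   Context: For $w = w(x,y) \in F(x,y)$ and $a, b \in G$, $w(a,b)$ denotes the image of $w$ under the unique homomorphism $F(x,y) \to G$ with $x \mapsto a$, $y \mapsto b$. $\langle a, b \rangle$ denotes the subgroup of $G$ generated by $a$ and $b$.
   Formalization: The finite simple group G is assumed non-abelian: for G cyclic of prime order every word gives w(a,b) = a^i b^j, and no such word is nontrivial exactly on the generating pairs, so the claim fails for every abelian simple group. *)

theory Defs
  imports "HOL-Algebra.SimpleGroups" "HOL-Algebra.Generated_Groups"
begin

section \<open>The free group on two generators\<close>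

datatype gen = GX | GY

text \<open>A letter \<open>(True, g)\<close> stands for the generator \<open>g\<close>, and \<open>(False, g)\<close> for its formal inverse.\<close>

type_synonym letter = "bool \<times> gen"

definition inv_letter :: "letter \<Rightarrow> letter" where
  "inv_letter l = (\<not> fst l, snd l)"

definition reduced :: "letter list \<Rightarrow> bool" where
  "reduced = successively (\<lambda>l m. m \<noteq> inv_letter l)"

fun push :: "letter \<Rightarrow> letter list \<Rightarrow> letter list" where
  "push l [] = [l]"
| "push l (m # ms) = (if m = inv_letter l then ms else l # m # ms)"

text \<open>Elements are reduced words; the product is concatenation followed by free reduction.\<close>

definition F2 :: "letter list monoid" where
  "F2 = \<lparr>carrier = {ws. reduced ws}, monoid.mult = foldr push, one = []\<rparr>"

abbreviation x_F2 :: "letter list" where "x_F2 \<equiv> [(True, GX)]"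
abbreviation y_F2 :: "letter list" where "y_F2 \<equiv> [(True, GY)]"

text \<open>
  The homomorphism from \<open>F2\<close> to \<open>G\<close> sending \<open>x\<close> to \<open>a\<close> and \<open>y\<close> to \<open>b\<close>. Restricting to
  extensional functions is needed for uniqueness, because HOL functions are total; existence
  and uniqueness are proved below in \<open>F2_universal\<close>.
\<close>

definition F2_hom :: "('g, 'm) monoid_scheme \<Rightarrow> 'g \<Rightarrow> 'g \<Rightarrow> letter list \<Rightarrow> 'g" where
  "F2_hom G a b = (THE h. h \<in> hom F2 G \<inter> extensional (carrier F2) \<and> h x_F2 = a \<and> h y_F2 = b)"

definition word_value :: "('g, 'm) monoid_scheme \<Rightarrow> letter list \<Rightarrow> 'g \<Rightarrow> 'g \<Rightarrow> 'g" where
  "word_value G w a b = F2_hom G a b w"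


subsection \<open>Group structure\<close>

lemma inv_letter_inv [simp]: "inv_letter (inv_letter l) = l"
  by (simp add: inv_letter_def)

lemma inv_letter_neq [simp]: "inv_letter l \<noteq> l" "l \<noteq> inv_letter l"
  by (auto simp: inv_letter_def prod_eq_iff)

lemma reduced_Nil [simp]: "reduced []"
  by (simp add: reduced_def)

lemma reduced_single [simp]: "reduced [l]"
  by (simp add: reduced_def)

lemma reduced_Cons_Cons: "reduced (l # m # ms) \<longleftrightarrow> m \<noteq> inv_letter l \<and> reduced (m # ms)"
  by (simp add: reduced_def)

lemma reduced_ConsD: "reduced (l # ls) \<Longrightarrow> reduced ls"
  by (cases ls) (auto simp: reduced_Cons_Cons)

lemma push_reduced: "reduced (l # ls) \<Longrightarrow> push l ls = l # ls"
  by (cases ls) (auto simp: reduced_Cons_Cons)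

lemma reduced_push: "reduced ws \<Longrightarrow> reduced (push l ws)"
  by (cases ws) (auto simp: reduced_Cons_Cons dest: reduced_ConsD)

lemma reduced_foldr_push: "reduced v \<Longrightarrow> reduced (foldr push u v)"
  by (induction u) (auto intro: reduced_push)

lemma push_push_inv: "reduced ws \<Longrightarrow> push l (push (inv_letter l) ws) = ws"
  by (cases ws) (auto simp: push_reduced)

lemma foldr_push_push:
  assumes "reduced w"
  shows "foldr push (push l v) w = push l (foldr push v w)"
proof (cases v)
  case (Cons m ms)
  then show ?thesis
    using push_push_inv[OF reduced_foldr_push[OF assms, of ms], of l] by auto
qed auto

lemma foldr_push_assoc:
  "reduced w \<Longrightarrow> foldr push (foldr push u v) w = foldr push u (foldr push v w)"
  by (induction u) (auto simp: foldr_push_push)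

lemma foldr_push_Nil: "reduced u \<Longrightarrow> foldr push u [] = u"
proof (induction u)
  case (Cons l u)
  then show ?case using reduced_ConsD[OF Cons.prems] by (simp add: push_reduced)
qed simp

lemma foldr_push_left_inverse:
  "reduced w \<Longrightarrow> foldr push (rev (map inv_letter u)) (foldr push u w) = w"
proof (induction u arbitrary: w)
  case (Cons l u)
  have "push (inv_letter l) (push l (foldr push u w)) = foldr push u w"
    using push_push_inv[OF reduced_foldr_push[OF Cons.prems, of u], of "inv_letter l"] by simp
  then show ?case using Cons by simp
qed simp

lemma group_F2: "group F2"
proof (rule groupI)
  fix u assume u: "u \<in> carrier F2"
  define v where "v = foldr push (rev (map inv_letter u)) []"
  have "foldr push v u = foldr push (rev (map inv_letter u)) (foldr push u [])"
    using u by (simp add: v_def foldr_push_assoc foldr_push_Nil F2_def)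
  also have "\<dots> = []" by (simp add: foldr_push_left_inverse)
  finally show "\<exists>v\<in>carrier F2. v \<otimes>\<^bsub>F2\<^esub> u = \<one>\<^bsub>F2\<^esub>"
    by (intro bexI[of _ v]) (auto simp: F2_def v_def reduced_foldr_push)
qed (auto simp: F2_def reduced_foldr_push foldr_push_assoc)

lemma inv_F2_single: "inv\<^bsub>F2\<^esub> [l] = [inv_letter l]"
  by (rule group.inv_equality[OF group_F2]) (auto simp: F2_def)


subsection \<open>Universal property\<close>

fun letter_value :: "('g, 'm) monoid_scheme \<Rightarrow> 'g \<Rightarrow> 'g \<Rightarrow> letter \<Rightarrow> 'g" where
  "letter_value G a b (s, g) =
     (let c = (case g of GX \<Rightarrow> a | GY \<Rightarrow> b) in if s then c else inv\<^bsub>G\<^esub> c)"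

definition letters_value :: "('g, 'm) monoid_scheme \<Rightarrow> 'g \<Rightarrow> 'g \<Rightarrow> letter list \<Rightarrow> 'g" where
  "letters_value G a b ls = foldr (\<lambda>l c. letter_value G a b l \<otimes>\<^bsub>G\<^esub> c) ls \<one>\<^bsub>G\<^esub>"

lemma letters_value_Nil [simp]: "letters_value G a b [] = \<one>\<^bsub>G\<^esub>"
  by (simp add: letters_value_def)

lemma letters_value_Cons [simp]:
  "letters_value G a b (l # ls) = letter_value G a b l \<otimes>\<^bsub>G\<^esub> letters_value G a b ls"
  by (simp add: letters_value_def)

context group
begin

lemma letter_value_closed [simp]:
  "\<lbrakk>a \<in> carrier G; b \<in> carrier G\<rbrakk> \<Longrightarrow> letter_value G a b l \<in> carrier G"
  by (cases l; cases "snd l") auto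

lemma letter_value_inv:
  "\<lbrakk>a \<in> carrier G; b \<in> carrier G\<rbrakk> \<Longrightarrow> letter_value G a b (inv_letter l) = inv letter_value G a b l"
  by (cases l; cases "snd l") (auto simp: inv_letter_def)

lemma letters_value_closed [simp]:
  "\<lbrakk>a \<in> carrier G; b \<in> carrier G\<rbrakk> \<Longrightarrow> letters_value G a b ls \<in> carrier G"
  by (induction ls) auto

lemma letters_value_push:
  assumes "a \<in> carrier G" "b \<in> carrier G"
  shows "letters_value G a b (push l ls) = letter_value G a b l \<otimes> letters_value G a b ls"
  using assms by (cases ls) (auto simp: letter_value_inv m_assoc[symmetric])

lemma letters_value_foldr_push:
  assumes "a \<in> carrier G" "b \<in> carrier G"
  shows "letters_value G a b (foldr push u v) = letters_value G a b u \<otimes> letters_value G a b v"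
  using assms by (induction u) (auto simp: letters_value_push m_assoc)

lemma letters_value_hom:
  assumes "a \<in> carrier G" "b \<in> carrier G"
  shows "restrict (letters_value G a b) (carrier F2) \<in> hom F2 G"
  using assms by (auto simp: hom_def F2_def reduced_foldr_push letters_value_foldr_push)

lemma F2_hom_eq_letters_value:
  assumes h: "h \<in> hom F2 G" "h x_F2 = a" "h y_F2 = b" and w: "w \<in> carrier F2"
  shows "h w = letters_value G a b w"
proof -
  interpret h: group_hom F2 G h
    by (simp add: group_hom_def group_hom_axioms_def group_F2 h is_group)
  have single: "h [l] = letter_value G a b l" for l
  proof (cases l)
    case (Pair s g)
    have pos: "h [(True, g)] = (case g of GX \<Rightarrow> a | GY \<Rightarrow> b)"
      using h by (cases g) auto
    have "[(True, g)] \<in> carrier F2" by (simp add: F2_def)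
    from h.hom_inv[OF this] have "h [(False, g)] = inv h [(True, g)]"
      by (simp add: inv_F2_single inv_letter_def)
    with pos Pair show ?thesis by (cases s) auto
  qed
  have "reduced w" using w by (simp add: F2_def)
  then show ?thesis
  proof (induction w)
    case Nil
    show ?case using h.hom_one by (simp add: F2_def)
  next
    case (Cons l ls)
    have "[l] \<in> carrier F2" "ls \<in> carrier F2"
      using reduced_ConsD[OF Cons.prems] by (simp_all add: F2_def)
    from h.hom_mult[OF this] have "h (l # ls) = h [l] \<otimes> h ls"
      using push_reduced[OF Cons.prems] by (simp add: F2_def)
    then show ?case using Cons.IH reduced_ConsD[OF Cons.prems] single by simp
  qed
qed

lemma F2_universal:
  assumes "a \<in> carrier G" "b \<in> carrier G"
  shows "\<exists>!h. h \<in> hom F2 G \<inter> extensional (carrier F2) \<and> h x_F2 = a \<and> h y_F2 = b"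
proof (rule ex1I)
  show "restrict (letters_value G a b) (carrier F2) \<in> hom F2 G \<inter> extensional (carrier F2)
    \<and> restrict (letters_value G a b) (carrier F2) x_F2 = a
    \<and> restrict (letters_value G a b) (carrier F2) y_F2 = b"
    using assms letters_value_hom[OF assms] by (auto simp: F2_def)
next
  fix h assume h: "h \<in> hom F2 G \<inter> extensional (carrier F2) \<and> h x_F2 = a \<and> h y_F2 = b"
  show "h = restrict (letters_value G a b) (carrier F2)"
    by (rule extensionalityI[of _ "carrier F2"]) (use h F2_hom_eq_letters_value in auto)
qed

lemma F2_hom:
  assumes "a \<in> carrier G" "b \<in> carrier G"
  shows "F2_hom G a b \<in> hom F2 G" "F2_hom G a b x_F2 = a" "F2_hom G a b y_F2 = b"
  using theI'[OF F2_universal[OF assms]] unfolding F2_hom_def by auto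

lemma word_value_eq:
  assumes "a \<in> carrier G" "b \<in> carrier G" "w \<in> carrier F2"
  shows "word_value G w a b = letters_value G a b w"
  unfolding word_value_def
  by (rule F2_hom_eq_letters_value[OF F2_hom[OF assms(1,2)] assms(3)])

end


section \<open>Abelian simple groups\<close>

text \<open>
  No word detects generating pairs in a simple group of prime order, since there
  \<open>w(a, b) = a\<^sup>i b\<^sup>j\<close> for fixed integers \<open>i\<close>, \<open>j\<close>. Hence simple groups have to be understood as
  non-abelian when such words are sought.
\<close>

lemma (in comm_group) letters_value_int_pow:
  "\<exists>(i::int) (j::int). \<forall>a\<in>carrier G. \<forall>b\<in>carrier G. letters_value G a b w = a [^] i \<otimes> b [^] j"
proof (induction w)
  case Nil
  show ?case by (rule exI[of _ "0::int"], rule exI[of _ "0::int"]) simp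
next
  case (Cons l w)
  then obtain i j :: int where
    ij: "\<forall>a\<in>carrier G. \<forall>b\<in>carrier G. letters_value G a b w = a [^] i \<otimes> b [^] j" by blast
  obtain s g where l: "l = (s, g)" by (cases l)
  define k :: int where "k = (if s then 1 else -1)"
  have k: "c [^] k = (if s then c else inv c)" if "c \<in> carrier G" for c
    using that by (auto simp: k_def int_pow_neg)
  show ?case
  proof (cases g)
    case GX
    have "letters_value G a b (l # w) = a [^] (k + i) \<otimes> b [^] j"
      if ab: "a \<in> carrier G" "b \<in> carrier G" for a b
    proof -
      have "letters_value G a b (l # w) = a [^] k \<otimes> (a [^] i \<otimes> b [^] j)"
        using ij ab k[of a] by (simp add: l GX)
      also have "\<dots> = a [^] (k + i) \<otimes> b [^] j"
        using ab by (simp add: int_pow_mult m_assoc)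
      finally show ?thesis .
    qed
    then show ?thesis by blast
  next
    case GY
    have "letters_value G a b (l # w) = a [^] i \<otimes> b [^] (k + j)"
      if ab: "a \<in> carrier G" "b \<in> carrier G" for a b
    proof -
      have "letters_value G a b (l # w) = b [^] k \<otimes> (a [^] i \<otimes> b [^] j)"
        using ij ab k[of b] by (simp add: l GY)
      also have "\<dots> = a [^] i \<otimes> b [^] (k + j)"
        using ab by (simp add: int_pow_mult m_lcomm)
      finally show ?thesis .
    qed
    then show ?thesis by blast
  qed
qed

lemma abelian_simple_no_generation_word:
  fixes G (structure)
  assumes "simple_group G" "comm_group G"
  shows "\<not> (\<exists>w\<in>carrier F2. \<forall>a\<in>carrier G. \<forall>b\<in>carrier G.
    word_value G w a b \<noteq> \<one> \<longleftrightarrow> generate G {a, b} = carrier G)"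
proof
  interpret simple_group G by fact
  interpret comm_group G by fact
  assume "\<exists>w\<in>carrier F2. \<forall>a\<in>carrier G. \<forall>b\<in>carrier G.
    word_value G w a b \<noteq> \<one> \<longleftrightarrow> generate G {a, b} = carrier G"
  then obtain w where "w \<in> carrier F2" and w: "\<forall>a\<in>carrier G. \<forall>b\<in>carrier G.
    letters_value G a b w \<noteq> \<one> \<longleftrightarrow> generate G {a, b} = carrier G"
    by (auto simp: word_value_eq)
  obtain i j :: int where
    ij: "\<And>a b. \<lbrakk>a \<in> carrier G; b \<in> carrier G\<rbrakk> \<Longrightarrow> letters_value G a b w = a [^] i \<otimes> b [^] j"
    using letters_value_int_pow[of w] by blast
  have gen: "generate G {a, b} = carrier G"
    if "a \<in> carrier G" "b \<in> carrier G" "a \<noteq> \<one> \<or> b \<noteq> \<one>" for a b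
  proof -
    have "generate G {a, b} \<lhd> G"
      using that by (intro subgroup_imp_normal generate_is_subgroup) auto
    moreover have "a \<in> generate G {a, b}" "b \<in> generate G {a, b}"
      by (auto intro: generate.incl)
    ultimately show ?thesis using no_real_normal_subgroup that(3) by blast
  qed
  obtain g where g: "g \<in> carrier G" "g \<noteq> \<one>"
    using simple_not_triv one_closed by blast
  have "g [^] i \<noteq> \<one>"
  proof -
    have "letters_value G g \<one> w \<noteq> \<one>"
      using w gen[of g \<one>] g by blast
    then show ?thesis using ij[of g \<one>] g by simp
  qed
  then have "generate G {g [^] j, g [^] (- i)} = carrier G"
    using g by (intro gen) (auto simp: int_pow_neg)
  then have "letters_value G (g [^] j) (g [^] (- i)) w \<noteq> \<one>"
    using w int_pow_closed[OF g(1)] by blast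
  then have "(g [^] j) [^] i \<otimes> (g [^] (- i)) [^] j \<noteq> \<one>"
    by (simp only: ij[OF int_pow_closed[OF g(1)] int_pow_closed[OF g(1)]] not_False_eq_True)
  moreover have "(g [^] j) [^] i \<otimes> (g [^] (- i)) [^] j = g [^] (j * i + (- i) * j)"
    using g by (simp only: int_pow_pow int_pow_mult int_pow_closed)
  ultimately show False by simp
qed

end

theory Submission
  imports Defs
begin

text \<open>
  Evaluation at a pair \<open>(a, b)\<close> is a homomorphism from the free group with image
  \<open>\<langle>a, b\<rangle>\<close>. Let \<open>K(a, b)\<close> be its kernel. The word wanted lies in \<open>K(a, b)\<close> for every
  pair that does not generate \<open>G\<close>, and avoids \<open>K(a, b)\<close> for every pair that does. Since \<open>G\<close> is
  finite, only finitely many kernels occur, and the problem has the shape of prime avoidance in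
  commutative algebra.

  The role of prime ideals is played by normal subgroups \<open>M\<close> for which an intersection of two
  normal subgroups lies in \<open>M\<close> only if one of them does. The kernel of a surjection onto a
  non-abelian simple group has this property (\<open>meet_prime_kernel\<close>): if neither \<open>A\<close> nor \<open>B\<close> is
  contained in it, both are mapped onto the whole group, and since all commutators
  \<open>[u, v]\<close> with \<open>u \<in> A\<close>, \<open>v \<in> B\<close> lie in \<open>A \<inter> B\<close>, the images of \<open>A\<close> and \<open>B\<close> commute as soon as
  \<open>A \<inter> B\<close> is mapped to the identity.

  Avoidance (\<open>meet_prime_avoidance\<close>) then yields the word, provided that no kernel of a
  non-generating pair is contained in the kernel of a generating pair and that the kernels of the
  generating pairs form an antichain. Both are questions of cardinality: an inclusion
  \<open>K(a, b) \<subseteq> K(c, d)\<close> with \<open>(c, d)\<close> generating makes \<open>\<langle>a, b\<rangle>\<close> map onto \<open>G\<close>, so that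
  \<open>\<langle>a, b\<rangle> = G\<close> and the induced surjection of the finite group \<open>G\<close> to itself is injective, which
  means that the kernels are equal (\<open>kernel_eqI_card\<close>).
\<close>

section \<open>Prime normal subgroups\<close>

definition meet_prime :: "('f, 'm) monoid_scheme \<Rightarrow> 'f set \<Rightarrow> bool" where
  "meet_prime F M \<longleftrightarrow> M \<lhd> F \<and> M \<noteq> carrier F \<and>
     (\<forall>A B. A \<lhd> F \<longrightarrow> B \<lhd> F \<longrightarrow> A \<inter> B \<subseteq> M \<longrightarrow> A \<subseteq> M \<or> B \<subseteq> M)"

lemma (in group) normal_carrier: "carrier G \<lhd> G"
  by (simp add: normal_inv_iff subgroup_self)

text \<open>
  The intersection with the carrier only matters for the empty family, whose intersection is taken
  to be the whole group.
\<close>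

lemma (in group) normal_Inter_carrier:
  assumes "finite \<K>" "\<forall>K\<in>\<K>. K \<lhd> G"
  shows "carrier G \<inter> \<Inter>\<K> \<lhd> G"
  using assms
proof (induction \<K>)
  case (insert K \<K>)
  then have "K \<inter> (carrier G \<inter> \<Inter>\<K>) \<lhd> G"
    using normal_subgroup_intersect[of K] by auto
  then show ?case by (simp add: Int_left_commute)
qed (simp add: normal_carrier)

lemma (in group) meet_prime_Inter:
  assumes "meet_prime G M" "finite \<K>" "\<forall>K\<in>\<K>. K \<lhd> G" "carrier G \<inter> \<Inter>\<K> \<subseteq> M"
  shows "\<exists>K\<in>\<K>. K \<subseteq> M"
  using assms(2-)
proof (induction \<K>)
  case empty
  have "M \<subseteq> carrier G"
    using assms(1) by (auto simp: meet_prime_def dest: normal_imp_subgroup subgroup.subset)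
  then show ?case using assms(1) empty by (auto simp: meet_prime_def)
next
  case (insert K \<K>)
  have "K \<inter> (carrier G \<inter> \<Inter>\<K>) \<subseteq> M" using insert.prems by auto
  moreover have "carrier G \<inter> \<Inter>\<K> \<lhd> G"
    using insert by (intro normal_Inter_carrier) auto
  ultimately have "K \<subseteq> M \<or> carrier G \<inter> \<Inter>\<K> \<subseteq> M"
    using assms(1) insert.prems unfolding meet_prime_def by blast
  then show ?case using insert by auto
qed

text \<open>
  The members of \<open>\<M>\<close> are avoided one at a time. If the element found so far falls into the next
  member \<open>M\<close>, it is multiplied by an element outside \<open>M\<close> of the intersection of \<open>\<K>\<close> and all
  members already avoided. Since \<open>M\<close> is prime, such an element can be missing only if \<open>M\<close> contains
  one of the sets intersected, which the antichain condition excludes for the members of \<open>\<M>\<close>.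
\<close>

lemma (in group) meet_prime_avoidance:
  assumes "finite \<M>" "\<forall>M\<in>\<M>. meet_prime G M"
    and antichain: "\<forall>M\<in>\<M>. \<forall>M'\<in>\<M>. M \<subseteq> M' \<longrightarrow> M = M'"
    and \<K>: "finite \<K>" "\<forall>K\<in>\<K>. K \<lhd> G" "\<forall>K\<in>\<K>. \<forall>M\<in>\<M>. \<not> K \<subseteq> M"
  shows "\<exists>w \<in> carrier G \<inter> \<Inter>\<K>. \<forall>M\<in>\<M>. w \<notin> M"
  using assms(1,2) antichain \<K>(3)
proof (induction \<M>)
  case empty
  have "subgroup (carrier G \<inter> \<Inter>\<K>) G"
    using normal_Inter_carrier[OF \<K>(1,2)] by (rule normal_imp_subgroup)
  then show ?case using subgroup.one_closed by blast
next
  case (insert M \<M>)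
  then have "\<exists>w \<in> carrier G \<inter> \<Inter>\<K>. \<forall>M\<in>\<M>. w \<notin> M"
    by (intro insert.IH) auto
  then obtain w where w: "w \<in> carrier G \<inter> \<Inter>\<K>" "\<forall>M\<in>\<M>. w \<notin> M" by blast
  show ?case
  proof (cases "w \<in> M")
    case False
    then show ?thesis using w by auto
  next
    case True
    have normals: "\<forall>K\<in>\<K> \<union> \<M>. K \<lhd> G"
      using \<K>(2) insert.prems(1) by (auto simp: meet_prime_def)
    have "\<forall>K\<in>\<K> \<union> \<M>. \<not> K \<subseteq> M"
      using insert.prems(2,3) insert.hyps(2) by auto
    then have "\<not> carrier G \<inter> \<Inter>(\<K> \<union> \<M>) \<subseteq> M"
      using meet_prime_Inter[of M "\<K> \<union> \<M>"] insert.prems(1) insert.hyps(1) \<K>(1) normals by blast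
    then obtain v where v: "v \<in> carrier G" "v \<in> \<Inter>\<K>" "\<forall>M\<in>\<M>. v \<in> M" "v \<notin> M" by blast
    have "w \<otimes> v \<in> carrier G \<inter> \<Inter>\<K>"
      using normal_Inter_carrier[OF \<K>(1,2)] w(1) v(1,2)
      by (intro subgroup.m_closed[OF normal_imp_subgroup]) auto
    moreover have "w \<otimes> v \<notin> N" if "N \<in> \<M>" for N
    proof
      assume "w \<otimes> v \<in> N"
      have N: "subgroup N G" using normals that normal_imp_subgroup by blast
      have "(w \<otimes> v) \<otimes> inv v \<in> N"
        using N v(3) that \<open>w \<otimes> v \<in> N\<close> by (simp add: subgroupE)
      then show False using w v(1) that by (simp add: m_assoc)
    qed
    moreover have "w \<otimes> v \<notin> M"
    proof
      assume "w \<otimes> v \<in> M"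
      have M: "subgroup M G"
        using insert.prems(1) normal_imp_subgroup by (auto simp: meet_prime_def)
      have "inv w \<otimes> (w \<otimes> v) \<in> M"
        using M True \<open>w \<otimes> v \<in> M\<close> by (simp add: subgroupE)
      then show False using w(1) v(1,4) by (simp add: m_assoc[symmetric])
    qed
    ultimately show ?thesis by blast
  qed
qed


section \<open>Kernels\<close>

lemma (in group) commutator_mem_normal_Int:
  assumes "A \<lhd> G" "B \<lhd> G" "u \<in> A" "v \<in> B"
  shows "u \<otimes> v \<otimes> inv u \<otimes> inv v \<in> A \<inter> B"
proof
  have A: "subgroup A G" and B: "subgroup B G" 
    using assms(1,2) by (simp_all add: normal_imp_subgroup)
  have uv: "u \<in> carrier G" "v \<in> carrier G"
    using subgroup.mem_carrier[OF A assms(3)] subgroup.mem_carrier[OF B assms(4)] by auto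
  have "v \<otimes> inv u \<otimes> inv v \<in> A"
    using assms(1,3) A uv(2) by (simp add: normal_inv_iff subgroupE(3))
  then have "u \<otimes> (v \<otimes> inv u \<otimes> inv v) \<in> A" using subgroupE(4)[OF A assms(3)] by blast
  then show "u \<otimes> v \<otimes> inv u \<otimes> inv v \<in> A" using uv by (simp add: m_assoc)
  have "u \<otimes> v \<otimes> inv u \<in> B" using assms(2,4) uv(1) by (simp add: normal_inv_iff)
  then show "u \<otimes> v \<otimes> inv u \<otimes> inv v \<in> B"
    using subgroupE(4)[OF B] subgroupE(3)[OF B assms(4)] by blast
qed

text \<open>
  A normal subgroup not contained in the kernel is mapped onto \<open>G\<close> by simplicity, so two such
  subgroups \<open>A\<close>, \<open>B\<close> provide preimages of any two elements of \<open>G\<close>. The commutator of these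
  preimages lies in \<open>A \<inter> B\<close>; if \<open>A \<inter> B\<close> were in the kernel, \<open>G\<close> would be abelian.
\<close>

lemma meet_prime_kernel:
  assumes "group_hom F G h" "simple_group G" "\<not> comm_group G" "h ` carrier F = carrier G"
  shows "meet_prime F (kernel F G h)"
  unfolding meet_prime_def
proof (intro conjI allI impI)
  interpret S: simple_group G by fact
  interpret h: group_hom F G h by fact
  show "kernel F G h \<lhd> F" by (rule h.normal_kernel)
  show "kernel F G h \<noteq> carrier F"
  proof
    assume "kernel F G h = carrier F"
    then have "h ` carrier F \<subseteq> {\<one>\<^bsub>G\<^esub>}" by (auto simp: kernel_def)
    then show False using assms(4) S.simple_not_triv S.one_closed by blast
  qed
  have onto: "h ` A = carrier G" if "A \<lhd> F" "\<not> A \<subseteq> kernel F G h" for A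
  proof -
    have "h ` A \<lhd> G"
      using normal.surj_hom_normal_subgroup[OF that(1) assms(1,4)] .
    moreover have "h ` A \<noteq> {\<one>\<^bsub>G\<^esub>}"
      using that normal_imp_subgroup[OF that(1)] subgroup.subset by (fastforce simp: kernel_def)
    ultimately show ?thesis using S.no_real_normal_subgroup by blast
  qed
  fix A B assume A: "A \<lhd> F" and B: "B \<lhd> F" and AB: "A \<inter> B \<subseteq> kernel F G h"
  show "A \<subseteq> kernel F G h \<or> B \<subseteq> kernel F G h"
  proof (rule ccontr)
    assume "\<not> ?thesis"
    then have hA: "h ` A = carrier G" and hB: "h ` B = carrier G" using onto A B by auto
    have "comm_group G"
    proof (rule S.group_comm_groupI)
      fix x y assume x: "x \<in> carrier G" and y: "y \<in> carrier G"
      then obtain u v where uv: "u \<in> A" "v \<in> B" "x = h u" "y = h v" using hA hB by blast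
      have c: "u \<in> carrier F" "v \<in> carrier F"
        using subgroup.mem_carrier[OF normal_imp_subgroup[OF A] uv(1)]
        subgroup.mem_carrier[OF normal_imp_subgroup[OF B] uv(2)] by auto
      have "h (u \<otimes>\<^bsub>F\<^esub> v \<otimes>\<^bsub>F\<^esub> inv\<^bsub>F\<^esub> u \<otimes>\<^bsub>F\<^esub> inv\<^bsub>F\<^esub> v) = \<one>\<^bsub>G\<^esub>"
        using h.G.commutator_mem_normal_Int[OF A B uv(1,2)] AB by (auto simp: kernel_def)
      then have "x \<otimes>\<^bsub>G\<^esub> y \<otimes>\<^bsub>G\<^esub> inv\<^bsub>G\<^esub> x \<otimes>\<^bsub>G\<^esub> inv\<^bsub>G\<^esub> y = \<one>\<^bsub>G\<^esub>"
        using c uv by simp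
      then have "x \<otimes>\<^bsub>G\<^esub> y \<otimes>\<^bsub>G\<^esub> inv\<^bsub>G\<^esub> (y \<otimes>\<^bsub>G\<^esub> x) = \<one>\<^bsub>G\<^esub>"
        using x y by (simp add: S.inv_mult_group S.m_assoc)
      then show "x \<otimes>\<^bsub>G\<^esub> y = y \<otimes>\<^bsub>G\<^esub> x"
        using x y by (subst (asm) S.inv_solve_right') simp_all
    qed
    then show False using assms(3) by simp
  qed
qed

lemma (in group_hom) eq_iff_kernel:
  assumes "u \<in> carrier G" "v \<in> carrier G"
  shows "h u = h v \<longleftrightarrow> u \<otimes> inv v \<in> kernel G H h"
proof -
  have "h (u \<otimes> inv v) = h u \<otimes>\<^bsub>H\<^esub> inv\<^bsub>H\<^esub> h v" using assms by simp
  then show ?thesis using assms by (simp add: kernel_def H.inv_solve_right')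
qed

text \<open>
  The inclusion of kernels makes \<open>f u \<mapsto> g u\<close> a well-defined surjection between the images; the
  bound on the cardinalities forces it to be a bijection.
\<close>

lemma kernel_eqI_card:
  assumes "group_hom F H f" "group_hom F H' g" "kernel F H f \<subseteq> kernel F H' g"
    and fin: "finite (f ` carrier F)" and card: "card (f ` carrier F) \<le> card (g ` carrier F)"
  shows "card (f ` carrier F) = card (g ` carrier F)" "kernel F H f = kernel F H' g"
proof -
  interpret f: group_hom F H f by fact
  interpret g: group_hom F H' g by fact
  define \<phi> where "\<phi> = g \<circ> inv_into (carrier F) f"
  have \<phi>: "\<phi> (f u) = g u" if u: "u \<in> carrier F" for u
  proof -
    define v where "v = inv_into (carrier F) f (f u)"
    have v: "v \<in> carrier F" "f v = f u"
      unfolding v_def using u by (auto intro: inv_into_into f_inv_into_f)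
    then have "v \<otimes>\<^bsub>F\<^esub> inv\<^bsub>F\<^esub> u \<in> kernel F H' g"
      using f.eq_iff_kernel[OF v(1) u] assms(3) by auto
    then show ?thesis using g.eq_iff_kernel[OF v(1) u] by (simp add: \<phi>_def v_def)
  qed
  have im: "\<phi> ` f ` carrier F = g ` carrier F" using \<phi> by (auto simp: image_image)
  show eq: "card (f ` carrier F) = card (g ` carrier F)"
    using card card_image_le[OF fin, of \<phi>] im by simp
  have inj: "inj_on \<phi> (f ` carrier F)"
    using im eq fin by (intro eq_card_imp_inj_on) simp_all
  have "u \<in> kernel F H f" if "u \<in> kernel F H' g" for u
  proof -
    have u: "u \<in> carrier F" "g u = \<one>\<^bsub>H'\<^esub>" using that by (auto simp: kernel_def)
    then have "\<phi> (f u) = \<phi> (f \<one>\<^bsub>F\<^esub>)"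
      using \<phi>[OF u(1)] \<phi>[OF f.G.one_closed] g.hom_one by simp
    then have "f u = f \<one>\<^bsub>F\<^esub>"
      using inj_onD[OF inj] u(1) f.G.one_closed by blast
    then show ?thesis using u(1) by (simp add: kernel_def)
  qed
  then show "kernel F H f = kernel F H' g" using assms(3) by blast
qed


section \<open>Evaluation of words\<close>

lemma (in group) group_hom_F2_hom:
  assumes "a \<in> carrier G" "b \<in> carrier G"
  shows "group_hom F2 G (F2_hom G a b)"
  using F2_hom[OF assms] group_F2 by (simp add: group_hom_def group_hom_axioms_def is_group)

lemma (in group) F2_hom_image:
  assumes "a \<in> carrier G" "b \<in> carrier G"
  shows "F2_hom G a b ` carrier F2 = generate G {a, b}"
proof
  have letters: "letters_value G a b w \<in> generate G {a, b}" for w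
  proof (induction w)
    case (Cons l w)
    have "letter_value G a b l \<in> generate G {a, b}"
      by (cases l; cases "snd l") (auto intro: generate.incl generate.inv)
    then show ?case using Cons by (simp add: generate.eng)
  qed (simp add: generate.one)
  then show "F2_hom G a b ` carrier F2 \<subseteq> generate G {a, b}"
    using F2_hom_eq_letters_value[OF F2_hom[OF assms]] by auto
  have "x_F2 \<in> carrier F2" "y_F2 \<in> carrier F2" by (simp_all add: F2_def)
  then have "{a, b} \<subseteq> F2_hom G a b ` carrier F2"
    using F2_hom(2,3)[OF assms] by (metis empty_subsetI image_eqI insert_subset)
  then show "generate G {a, b} \<subseteq> F2_hom G a b ` carrier F2"
    by (rule generate_subgroup_incl) (rule group_hom.img_is_subgroup[OF group_hom_F2_hom[OF assms]])
qed

theorem corollary2: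
  fixes G :: "('g, 'm) monoid_scheme" (structure)
  assumes "simple_group G" and "finite (carrier G)" and "\<not> comm_group G"
  shows "\<exists>w\<in>carrier F2. \<forall>a\<in>carrier G. \<forall>b\<in>carrier G.
    word_value G w a b \<noteq> \<one> \<longleftrightarrow> generate G {a, b} = carrier G"
proof -
  interpret simple_group G by fact
  define K where "K = (\<lambda>(a, b). kernel F2 G (F2_hom G a b))"
  define P where "P = {(a, b) \<in> carrier G \<times> carrier G. generate G {a, b} = carrier G}"
  define Q where "Q = carrier G \<times> carrier G - P"
  have fin: "finite P" "finite Q"
    using assms(2) by (auto simp: P_def Q_def intro: finite_subset[of _ "carrier G \<times> carrier G"])
  have normal: "K p \<lhd> F2" if "p \<in> carrier G \<times> carrier G" for p
    using that group_hom.normal_kernel[OF group_hom_F2_hom] by (auto simp: K_def)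
  have prime: "meet_prime F2 (K p)" if "p \<in> P" for p
    using that meet_prime_kernel[OF group_hom_F2_hom assms(1,3)] F2_hom_image
    by (auto simp: K_def P_def)
  \<comment> \<open>This yields both conditions of the avoidance lemma, on non-generating pairs and on the antichain.\<close>
  have incl: "p \<in> P \<and> K p = K q"
    if p: "p \<in> carrier G \<times> carrier G" and q: "q \<in> P" and pq: "K p \<subseteq> K q" for p q
  proof -
    obtain a b c d where [simp]: "p = (a, b)" "q = (c, d)" by (cases p, cases q)
    have ab: "a \<in> carrier G" "b \<in> carrier G" and cd: "c \<in> carrier G" "d \<in> carrier G"
      using p q by (auto simp: P_def)
    have sub: "generate G {a, b} \<subseteq> carrier G" using ab generate_incl by auto
    have im: "F2_hom G c d ` carrier F2 = carrier G" "F2_hom G a b ` carrier F2 \<subseteq> carrier G"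
      using q sub F2_hom_image ab cd by (auto simp: P_def)
    note * = kernel_eqI_card[OF group_hom_F2_hom[OF ab] group_hom_F2_hom[OF cd]]
    have le: "card (F2_hom G a b ` carrier F2) \<le> card (F2_hom G c d ` carrier F2)"
      using im assms(2) by (simp add: card_mono)
    have "card (F2_hom G a b ` carrier F2) = card (F2_hom G c d ` carrier F2)" "K p = K q"
      using * pq le finite_subset[OF im(2) assms(2)] by (auto simp: K_def)
    then show ?thesis
      using im card_subset_eq[OF assms(2) im(2)] F2_hom_image[OF ab] ab by (simp add: P_def)
  qed
  have "\<exists>w \<in> carrier F2 \<inter> \<Inter>(K ` Q). \<forall>M\<in>K ` P. w \<notin> M"
  proof (rule group.meet_prime_avoidance[OF group_F2])
    show "\<forall>M\<in>K ` P. \<forall>M'\<in>K ` P. M \<subseteq> M' \<longrightarrow> M = M'" using incl by (auto simp: P_def)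
    show "\<forall>N\<in>K ` Q. \<forall>M\<in>K ` P. \<not> N \<subseteq> M" using incl by (auto simp: Q_def)
  qed (use fin normal prime in \<open>auto simp: Q_def\<close>)
  then obtain w where w: "w \<in> carrier F2" "\<forall>p\<in>Q. w \<in> K p" "\<forall>p\<in>P. w \<notin> K p" by auto
  have "word_value G w a b \<noteq> \<one> \<longleftrightarrow> generate G {a, b} = carrier G"
    if "a \<in> carrier G" "b \<in> carrier G" for a b
  proof -
    have "word_value G w a b = \<one> \<longleftrightarrow> w \<in> K (a, b)"
      using w(1) by (simp add: word_value_def K_def kernel_def)
    also have "\<dots> \<longleftrightarrow> (a, b) \<notin> P" using w that by (auto simp: Q_def)
    finally show ?thesis using that by (simp add: P_def)
  qed
  then show ?thesis using w(1) by blast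
qed

end
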